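(* Let $1\le p\le\infty$ and let $A,B:L_p(\mathbb{R},\mu)\to L_p(\mathbb{R},\mu)$ be the operators defined, for almost every $t$, by $$(Ax)(t)=\int_{\alpha_1}^{\beta_1}I_{[\alpha,\beta]}(t)\Big(\frac{1}{\delta\sigma_2}\cos(\omega t)\cos(\omega s)-\frac{1}{\delta\sigma_1}\sin(\omega t)\sin(\omega s)+\theta_{A,4}\cos(\omega t)\sin(\omega s)\Big)x(s)\,d\mu_s,$$ $$(Bx)(t)=\int_{\alpha_1}^{\beta_1}I_{[\alpha,\beta]}(t)\,\theta_{B,2}\cos(\omega t)\cos(\omega s)x(s)\,d\mu_s,$$ where $\theta_{A,4},\theta_{B,2},\omega\in\mathbb{R}$, $\delta\in\mathbb{R}\setminus\{0\}$, $\alpha,\beta,\alpha_1,\beta_1\in\mathbb{R}$, $\alpha_1<\beta_1$, $\alpha\le\alpha_1$, $\beta\ge\beta_1$, either $\frac{\omega}{\pi}(\beta_1-\alpha_1)\in\mathbb{Z}$ or $\frac{\omega}{\pi}(\beta_1+\alpha_1)\in\mathbb{Z}$, and $\sigma_1\ne0$, $\sigma_2\neq0$. Let $\{\theta_n\}$ and $\{\varsigma_n\}$ be sequences of real numbers and let $A_n,B_n:L_p(\mathbb{R},\mu)\to L_p(\mathbb{R},\mu)$ be defined, for almost every $t$, by $$(A_nx)(t)=\int_{\alpha_1}^{\beta_1}I_{[\alpha,\beta]}(t)\Big(\frac{1}{\delta\sigma_2}\cos(\omega t)\cos(\omega s)-\frac{1}{\delta\sigma_1}\sin(\omega t)\sin(\omega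 s)+\theta_n\cos(\omega t)\sin(\omega s)\Big)x(s)\,d\mu_s,$$ $$(B_nx)(t)=\int_{\alpha_1}^{\beta_1}I_{[\alpha,\beta]}(t)\,\varsigma_n\cos(\omega t)\cos(\omega s)x(s)\,d\mu_s.$$ Then: 1. $AB=\delta BA^2$, $A_nB=\delta BA_n^2$, $A_nB_n=\delta B_nA_n^2$ and $AB_n=\delta B_nA^2$ for each positive integer $n$. Moreover, for all $x\in L_p(\mathbb{R},\mu)$ and almost every $t$, $$(AB-BA)x(t)=-\theta_{A,4}\sigma_2\theta_{B,2}\int_{\alpha_1}^{\beta_1}I_{[\alpha,\beta]}(t)\cos(\omega t)\sin(\omega s)x(s)\,d\mu_s.$$ 2. If $\theta_n\to0$ as $n\to\infty$, then $A_n\to\tilde A$ in norm, where, for almost every $t$, $$(\tilde Ax)(t)=\int_{\alpha_1}^{\beta_1}I_{[\alpha,\beta]}(t)\Big(\frac{1}{\delta\sigma_2}\cos(\omega t)\cos(\omega s)-\frac{1}{\delta\sigma_1}\sin(\omega t)\sin(\omega s)\Big)x(s)\,d\mu_s,$$ so $A_nB-BA_n\to0$ in norm and $\tilde AB=B\tilde A$. 3. If $\varsigma_n\to0$ as $n\to\infty$, then $B_n\to0$ in norm and so $AB_n-B_nA\to0$ in norm. 4. If $\theta_n\to0$ and $\varsigma_n\to0$ as $n\to\infty$, then $A_nB_n-B_nA_n\to0$ in norm. 5. Let $\lambda_0\in\mathrm{cl}(\Lambda)$. If $\theta_{A,4}\sigma_2\theta_{B,2}\tilde\lambda\to0$ when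 $(\theta_{A,4},\theta_{B,2},\alpha_1,\beta_1,\alpha,\beta,\sigma_1,\sigma_2,\delta,\omega)\to\lambda_0$ within $\Lambda$, then for all $x\in L_p(\mathbb{R},\mu)$ it holds that $\|(AB-BA)x\|_{L_p}\to0$ (along the same limit of parameters, $A$ and $B$ being the operators with these parameters).
   Context: $\mu$ is Lebesgue measure on $\mathbb{R}$; $L_p(\mathbb{R},\mu)$ is the real Lebesgue space; the index in $d\mu_s$ indicates the variable of integration; $I_E$ is the indicator function of the set $E$; convergence in norm means convergence in the operator norm on $L_p(\mathbb{R},\mu)$. The constants are $$\sigma_1=\int_{\alpha_1}^{\beta_1}(\sin(\omega s))^2d\mu_s,\qquad \sigma_2=\int_{\alpha_1}^{\beta_1}(\cos(\omega s))^2d\mu_s=\beta_1-\alpha_1-\sigma_1.$$ The parameter set is $$\Lambda=\Big\{(\theta_{A,4},\theta_{B,2},\alpha_1,\beta_1,\alpha,\beta,\sigma_1,\sigma_2,\delta,\omega)\in\mathbb{R}^{10}:\ \delta\ne0,\ \alpha_1<\beta_1,\ \alpha\le\alpha_1,\ \beta\ge\beta_1,\ \int_{\alpha_1}^{\beta_1}\sin(\omega s)\cos(\omega s)d\mu_s=0,\ \sigma_1=\int_{\alpha_1}^{\beta_1}(\sin(\omega s))^2d\mu_s\ne0,\ \sigma_2=\beta_1-\alpha_1-\sigma_1\ne0\Big\},$$ and $\mathrm{cl}(\Lambda)$ is its closure in $\mathbb{R}^{10}$. Further, $\tilde\lambda=|\beta-\alpha|^{1/p}|\beta_1-\alpha_1|^{1/q}$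 with $\frac1p+\frac1q=1$ if $1<p<\infty$, $\tilde\lambda=|\beta_1-\alpha_1|$ if $p=\infty$, and $\tilde\lambda=|\beta-\alpha|$ if $p=1$. *)

theory Defs
  imports "HOL-Probability.Essential_Supremum"
begin

text \<open>
  Elements of the real Lebesgue space are represented by functions; two functions denote the same
  element iff they agree almost everywhere. Accordingly, operators are maps on functions that
  respect almost-everywhere equality (\<open>Lp_operator\<close>), and equality of operators (\<open>op_eq\<close>) is
  almost-everywhere equality of the images of every element of the space.
\<close>

text \<open>
  The exponent ranges over the extended nonnegative reals. The norm takes the value \<open>\<infinity>\<close> on every
  function outside the space, including the non-measurable ones (\<open>esssup\<close> has the same convention).
\<close>

definition Lp_norm :: "ennreal \<Rightarrow> (real \<Rightarrow> real) \<Rightarrow> ennreal" where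
  "Lp_norm p f =
    (if f \<notin> borel_measurable lebesgue then \<infinity>
     else if p = \<infinity> then esssup lebesgue (\<lambda>t. ennreal \<bar>f t\<bar>)
     else let J = (\<integral>\<^sup>+ t. ennreal (\<bar>f t\<bar> powr enn2real p) \<partial>lebesgue)
          in if J = \<infinity> then \<infinity> else ennreal (enn2real J powr (1 / enn2real p)))"

definition Lp :: "ennreal \<Rightarrow> (real \<Rightarrow> real) set" where
  "Lp p = {f \<in> borel_measurable lebesgue. Lp_norm p f < \<infinity>}"

type_synonym fun_op = "(real \<Rightarrow> real) \<Rightarrow> (real \<Rightarrow> real)"

definition Lp_operator :: "ennreal \<Rightarrow> fun_op \<Rightarrow> bool" where
  "Lp_operator p T \<longleftrightarrow>
    (\<forall>x\<in>Lp p. T x \<in> Lp p) \<and>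
    (\<forall>x\<in>Lp p. \<forall>y\<in>Lp p. (AE t in lebesgue. x t = y t) \<longrightarrow> (AE t in lebesgue. T x t = T y t))"

definition op_eq :: "ennreal \<Rightarrow> fun_op \<Rightarrow> fun_op \<Rightarrow> bool" where
  "op_eq p S T \<longleftrightarrow> (\<forall>x\<in>Lp p. AE t in lebesgue. S x t = T x t)"

definition op_diff :: "fun_op \<Rightarrow> fun_op \<Rightarrow> fun_op" where
  "op_diff S T = (\<lambda>x t. S x t - T x t)"

definition op_scale :: "real \<Rightarrow> fun_op \<Rightarrow> fun_op" where
  "op_scale c T = (\<lambda>x t. c * T x t)"

definition op_zero :: fun_op where
  "op_zero = (\<lambda>x t. 0)"

definition op_norm :: "ennreal \<Rightarrow> fun_op \<Rightarrow> ennreal" where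
  "op_norm p T = (SUP x \<in> {x \<in> Lp p. Lp_norm p x \<le> 1}. Lp_norm p (T x))"

definition tends_in_norm :: "ennreal \<Rightarrow> (nat \<Rightarrow> fun_op) \<Rightarrow> fun_op \<Rightarrow> bool" where
  "tends_in_norm p T S \<longleftrightarrow> (\<lambda>n. op_norm p (op_diff (T n) S)) \<longlonglongrightarrow> 0"

definition opA :: "real \<Rightarrow> real \<Rightarrow> real \<Rightarrow> real \<Rightarrow> real \<Rightarrow> real \<Rightarrow> real \<Rightarrow> real \<Rightarrow> real \<Rightarrow> fun_op" where
  "opA \<alpha> \<beta> \<alpha>\<^sub>1 \<beta>\<^sub>1 \<sigma>\<^sub>1 \<sigma>\<^sub>2 \<delta> \<omega> \<theta> = (\<lambda>x t.
     LINT s:{\<alpha>\<^sub>1..\<beta>\<^sub>1}|lebesgue. indicator {\<alpha>..\<beta>} t *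
       (1 / (\<delta> * \<sigma>\<^sub>2) * cos (\<omega> * t) * cos (\<omega> * s)
        - 1 / (\<delta> * \<sigma>\<^sub>1) * sin (\<omega> * t) * sin (\<omega> * s)
        + \<theta> * cos (\<omega> * t) * sin (\<omega> * s)) * x s)"

definition opB :: "real \<Rightarrow> real \<Rightarrow> real \<Rightarrow> real \<Rightarrow> real \<Rightarrow> real \<Rightarrow> fun_op" where
  "opB \<alpha> \<beta> \<alpha>\<^sub>1 \<beta>\<^sub>1 \<omega> \<theta> = (\<lambda>x t.
     LINT s:{\<alpha>\<^sub>1..\<beta>\<^sub>1}|lebesgue. indicator {\<alpha>..\<beta>} t *
       (\<theta> * cos (\<omega> * t) * cos (\<omega> * s)) * x s)"

definition opA_lim :: "real \<Rightarrow> real \<Rightarrow> real \<Rightarrow> real \<Rightarrow> real \<Rightarrow> real \<Rightarrow> real \<Rightarrow> real \<Rightarrow> fun_op" where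
  "opA_lim \<alpha> \<beta> \<alpha>\<^sub>1 \<beta>\<^sub>1 \<sigma>\<^sub>1 \<sigma>\<^sub>2 \<delta> \<omega> = (\<lambda>x t.
     LINT s:{\<alpha>\<^sub>1..\<beta>\<^sub>1}|lebesgue. indicator {\<alpha>..\<beta>} t *
       (1 / (\<delta> * \<sigma>\<^sub>2) * cos (\<omega> * t) * cos (\<omega> * s)
        - 1 / (\<delta> * \<sigma>\<^sub>1) * sin (\<omega> * t) * sin (\<omega> * s)) * x s)"

text \<open>
  Parameter vectors are nested 10-tuples, in the order
  \<open>(\<theta>\<^sub>A, \<theta>\<^sub>B, \<alpha>\<^sub>1, \<beta>\<^sub>1, \<alpha>, \<beta>, \<sigma>\<^sub>1, \<sigma>\<^sub>2, \<delta>, \<omega>)\<close>. The product topology is that of ten-dimensional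
  Euclidean space.
\<close>

type_synonym params =
  "real \<times> real \<times> real \<times> real \<times> real \<times> real \<times> real \<times> real \<times> real \<times> real"

definition param_set :: "params set" where
  "param_set = {(\<theta>A, \<theta>B, \<alpha>\<^sub>1, \<beta>\<^sub>1, \<alpha>, \<beta>, \<sigma>\<^sub>1, \<sigma>\<^sub>2, \<delta>, \<omega>).
     \<delta> \<noteq> 0 \<and> \<alpha>\<^sub>1 < \<beta>\<^sub>1 \<and> \<alpha> \<le> \<alpha>\<^sub>1 \<and> \<beta> \<ge> \<beta>\<^sub>1 \<and>
     (LINT s:{\<alpha>\<^sub>1..\<beta>\<^sub>1}|lebesgue. sin (\<omega> * s) * cos (\<omega> * s)) = 0 \<and>
     \<sigma>\<^sub>1 = (LINT s:{\<alpha>\<^sub>1..\<beta>\<^sub>1}|lebesgue. (sin (\<omega> * s))\<^sup>2) \<and> \<sigma>\<^sub>1 \<noteq> 0 \<and>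
     \<sigma>\<^sub>2 = \<beta>\<^sub>1 - \<alpha>\<^sub>1 - \<sigma>\<^sub>1 \<and> \<sigma>\<^sub>2 \<noteq> 0}"

text \<open>For \<open>1 < p < \<infinity>\<close> the conjugate exponent is \<open>q = p / (p - 1)\<close>, i.e. \<open>1/p + 1/q = 1\<close>.\<close>

definition lambda_tilde :: "ennreal \<Rightarrow> real \<Rightarrow> real \<Rightarrow> real \<Rightarrow> real \<Rightarrow> real" where
  "lambda_tilde p \<alpha> \<beta> \<alpha>\<^sub>1 \<beta>\<^sub>1 =
    (if p = \<infinity> then \<bar>\<beta>\<^sub>1 - \<alpha>\<^sub>1\<bar>
     else if p = 1 then \<bar>\<beta> - \<alpha>\<bar>
     else let r = enn2real p; q = r / (r - 1)
          in \<bar>\<beta> - \<alpha>\<bar> powr (1 / r) * \<bar>\<beta>\<^sub>1 - \<alpha>\<^sub>1\<bar> powr (1 / q))"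

end

theory Submission
  imports Defs
begin

text \<open>
  Write \<open>C x\<close> and \<open>S x\<close> for the integrals of \<open>cos (\<omega> s) x s\<close> and \<open>sin (\<omega> s) x s\<close> over
  \<open>[\<alpha>\<^sub>1, \<beta>\<^sub>1]\<close>, and \<open>cw\<close>, \<open>sw\<close> for cosine and sine cut off outside \<open>[\<alpha>, \<beta>]\<close>. The kernels of
  the operators are sums of products, so that
  \<open>A x = (C x / (\<delta> \<sigma>\<^sub>2) + \<theta> S x) cw - (S x / (\<delta> \<sigma>\<^sub>1)) sw\<close> and \<open>B x = \<eta> C x cw\<close>
  (\<open>opA_eq\<close>, \<open>opB_eq\<close>): everything that the operators see of \<open>x\<close> is the pair \<open>(C x, S x)\<close>.

  The integrality condition on \<open>\<omega>\<close> makes sine and cosine orthogonal on \<open>[\<alpha>\<^sub>1, \<beta>\<^sub>1]\<close>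
  (\<open>sin_cos_orthogonal\<close>). Since \<open>[\<alpha>\<^sub>1, \<beta>\<^sub>1] \<subseteq> [\<alpha>, \<beta>]\<close>, the pair takes the values \<open>(\<sigma>\<^sub>2, 0)\<close> on
  \<open>cw\<close> and \<open>(0, \<sigma>\<^sub>1)\<close> on \<open>sw\<close>, so on pairs \<open>A\<close> and \<open>B\<close> act as the matrices with rows
  \<open>(1/\<delta>, \<theta> \<sigma>\<^sub>2), (0, -1/\<delta>)\<close> and \<open>(\<eta> \<sigma>\<^sub>2, 0), (0, 0)\<close> (\<open>moments_A\<close>, \<open>moments_B\<close>). The square of
  the first matrix is \<open>1/\<delta>\<^sup>2\<close> times the identity, so \<open>B A\<^sup>2 = B / \<delta>\<^sup>2\<close>; and \<open>A cw = cw / \<delta>\<close> gives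
  \<open>A B = B / \<delta>\<close>. Hence \<open>A B = \<delta> B A\<^sup>2\<close>, while the commutator is the rank-one operator
  \<open>x \<mapsto> - \<theta> \<sigma>\<^sub>2 \<eta> S x cw\<close> (\<open>commutator_eq\<close>).

  All the limits concern operators \<open>x \<mapsto> k F x g\<close> with a scalar \<open>k\<close>, a functional \<open>F\<close> bounded by
  the integral of \<open>\<bar>x\<bar>\<close> over \<open>[\<alpha>\<^sub>1, \<beta>\<^sub>1]\<close>, and \<open>\<bar>g\<bar>\<close> bounded by the indicator of \<open>[\<alpha>, \<beta>]\<close>.
  Hoelder's inequality bounds the norm of the image by \<open>\<bar>k\<bar>\<close> times the norm of \<open>x\<close> times the
  product of the \<open>p\<close>-norm of the indicator of \<open>[\<alpha>, \<beta>]\<close> and the dual norm of the indicator of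
  \<open>[\<alpha>\<^sub>1, \<beta>\<^sub>1]\<close> (\<open>Lp_norm_rank_one_le\<close>). That product is \<open>lambda_tilde\<close>. Thus the norms tend to
  zero with \<open>k\<close> for fixed intervals, and with \<open>k * lambda_tilde\<close> when the intervals vary.
\<close>

section \<open>Lebesgue norms on intervals\<close>

text \<open>The \<open>L\<^sub>p\<close> norm of the indicator of an interval of length \<open>L\<close>.\<close>

definition interval_norm :: "ennreal \<Rightarrow> real \<Rightarrow> real" where
  "interval_norm p L = (if p = \<infinity> then 1 else L powr (1 / enn2real p))"

text \<open>
  The \<open>L\<^sub>q\<close> norm of the same indicator, for the conjugate exponent \<open>q\<close>. Writing \<open>1/q\<close> as
  \<open>1 - 1/p\<close> covers \<open>p = 1\<close> together with the larger finite exponents: for \<open>L > 0\<close> the value there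
  is \<open>L powr 0 = 1\<close>.
\<close>

definition dual_interval_norm :: "ennreal \<Rightarrow> real \<Rightarrow> real" where
  "dual_interval_norm p L = (if p = \<infinity> then L else L powr (1 - 1 / enn2real p))"

lemma interval_norm_nonneg: "0 \<le> interval_norm p L"
  by (simp add: interval_norm_def)

lemma dual_interval_norm_nonneg: "0 \<le> L \<Longrightarrow> 0 \<le> dual_interval_norm p L"
  by (simp add: dual_interval_norm_def)

lemma one_le_enn2real: "1 \<le> p \<Longrightarrow> p \<noteq> \<infinity> \<Longrightarrow> 1 \<le> enn2real p"
  by (cases p) auto

lemma lambda_tilde_eq:
  assumes "1 \<le> p" "a < b" "\<alpha> \<le> \<beta>"
  shows "lambda_tilde p \<alpha> \<beta> a b = interval_norm p (\<beta> - \<alpha>) * dual_interval_norm p (b - a)"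
proof -
  have "(r - 1) / r = 1 - 1 / r" if "1 \<le> r" for r :: real
    using that by (simp add: field_simps)
  then show ?thesis
    using assms one_le_enn2real[of p]
    by (auto simp: lambda_tilde_def interval_norm_def dual_interval_norm_def Let_def)
qed

lemma Lp_norm_le_of_interval_support:
  assumes p: "1 \<le> p" and "\<alpha> \<le> \<beta>" "0 \<le> c"
    and f: "f \<in> borel_measurable lebesgue"
    and le: "\<And>t. \<bar>f t\<bar> \<le> c * indicator {\<alpha>..\<beta>} t"
  shows "Lp_norm p f \<le> ennreal (c * interval_norm p (\<beta> - \<alpha>))"
proof (cases "p = \<infinity>")
  case True
  have "\<bar>f t\<bar> \<le> c" for t
    using le[of t] \<open>0 \<le> c\<close> by (cases "t \<in> {\<alpha>..\<beta>}") auto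
  then have "esssup lebesgue (\<lambda>t. ennreal \<bar>f t\<bar>) \<le> ennreal c"
    using f by (intro esssup_I) (auto intro!: ennreal_leI)
  then show ?thesis
    using f True by (simp add: Lp_norm_def interval_norm_def)
next
  case False
  define r where "r = enn2real p"
  have r: "1 \<le> r"
    using one_le_enn2real[OF p False] by (simp add: r_def)
  define J where "J = (\<integral>\<^sup>+ t. ennreal (\<bar>f t\<bar> powr r) \<partial>lebesgue)"
  have "\<bar>f t\<bar> powr r \<le> c powr r * indicator {\<alpha>..\<beta>} t" for t
    using powr_mono2[OF _ _ le[of t], of r] r by (auto simp: indicator_def split: if_splits)
  then have "J \<le> (\<integral>\<^sup>+ t. ennreal (c powr r) * indicator {\<alpha>..\<beta>} t \<partial>lebesgue)"
    unfolding J_def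
    by (intro nn_integral_mono)
      (metis ennreal_indicator ennreal_leI ennreal_mult' powr_ge_zero)
  also have "\<dots> = ennreal (c powr r * (\<beta> - \<alpha>))"
    using \<open>\<alpha> \<le> \<beta>\<close> by (subst nn_integral_cmult_indicator) (auto simp: ennreal_mult)
  finally have J: "J \<le> ennreal (c powr r * (\<beta> - \<alpha>))" .
  then have fin: "J \<noteq> \<infinity>"
    by (auto simp: top_unique)
  have "enn2real J \<le> c powr r * (\<beta> - \<alpha>)"
    using enn2real_mono[OF J] \<open>\<alpha> \<le> \<beta>\<close> by simp
  then have "enn2real J powr (1 / r) \<le> (c powr r * (\<beta> - \<alpha>)) powr (1 / r)"
    using r by (intro powr_mono2) auto
  also have "\<dots> = c * (\<beta> - \<alpha>) powr (1 / r)"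
    using r \<open>0 \<le> c\<close> \<open>\<alpha> \<le> \<beta>\<close> by (simp add: powr_mult powr_powr)
  finally show ?thesis
    using f False fin
    by (auto simp: Lp_norm_def interval_norm_def Let_def J_def r_def intro!: ennreal_leI)
qed

text \<open>
  The graph of the convex function \<open>u powr r\<close> lies above its tangent at \<open>m\<close>. Integrating this
  bound in \<open>u = \<bar>x s\<bar>\<close> and then choosing the best \<open>m\<close> gives Hoelder's inequality against the
  constant function 1.
\<close>

lemma tangent_powr:
  fixes u m r :: real
  assumes "1 \<le> r" "0 \<le> u" "0 < m"
  shows "u \<le> (1 / r) * m powr (1 - r) * u powr r + (1 - 1 / r) * m"
proof (cases "u = 0")
  case False
  then have "0 < u" using assms by simp
  have "u = (u powr r * m powr (1 - r)) powr (1 / r) * m powr (1 - 1 / r)"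
    using \<open>0 < u\<close> assms by (simp add: powr_mult powr_powr diff_divide_distrib flip: powr_add)
  also have "\<dots> \<le> (1 / r) * (u powr r * m powr (1 - r)) + (1 - 1 / r) * m"
    using \<open>0 < u\<close> assms by (intro Youngs_inequality_0) auto
  finally show ?thesis by (simp add: mult_ac)
qed (use assms in auto)

text \<open>
  For finite \<open>p\<close> both claims come from integrating the tangent bound: with \<open>m = 1\<close> it gives a
  dominating function. The optimal \<open>m\<close> in the estimate is the \<open>p\<close>-th power mean
  \<open>(j / L) powr (1 / p)\<close> of \<open>\<bar>x\<bar>\<close>, with \<open>j\<close> the integral of \<open>\<bar>x\<bar> powr p\<close>; for \<open>j = 0\<close>, where
  this is not a positive number, \<open>m\<close> tends to 0 instead.
\<close>

lemma Lp_set_integrable_and_Holder: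
  assumes p: "1 \<le> p" and x: "x \<in> Lp p" and "a < b"
  shows "set_integrable lebesgue {a..b} x"
    and "(LINT s:{a..b}|lebesgue. \<bar>x s\<bar>) \<le> dual_interval_norm p (b - a) * enn2real (Lp_norm p x)"
proof -
  have [measurable]: "x \<in> borel_measurable lebesgue"
    using x by (simp add: Lp_def)
  have const: "set_integrable lebesgue {a..b} (\<lambda>_. c)" for c :: real
    by (intro absolutely_integrable_continuous_real continuous_intros)
  have const_int: "(LINT s:{a..b}|lebesgue. c) = (b - a) * c" for c :: real
    using \<open>a < b\<close> by (simp add: set_lebesgue_integral_def measure_def)
  have sbm: "set_borel_measurable lebesgue {a..b} x"
    unfolding set_borel_measurable_def
    by (intro borel_measurable_scaleR borel_measurable_indicator) auto
  have "set_integrable lebesgue {a..b} x \<and>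
    (LINT s:{a..b}|lebesgue. \<bar>x s\<bar>) \<le> dual_interval_norm p (b - a) * enn2real (Lp_norm p x)"
  proof (cases "p = \<infinity>")
    case True
    define N where "N = enn2real (Lp_norm p x)"
    have "esssup lebesgue (\<lambda>t. ennreal \<bar>x t\<bar>) = ennreal N"
      using x True by (auto simp: Lp_def Lp_norm_def N_def ennreal_enn2real_if split: if_splits)
    moreover have "0 \<le> N"
      by (simp add: N_def)
    ultimately have ae: "AE s in lebesgue. \<bar>x s\<bar> \<le> N"
      using esssup_AE[of "\<lambda>t. ennreal \<bar>x t\<bar>" lebesgue] by simp
    have int: "set_integrable lebesgue {a..b} x"
      by (rule set_integrable_bound[OF const[of N] sbm]) (use ae in eventually_elim, auto)
    have "(LINT s:{a..b}|lebesgue. \<bar>x s\<bar>) \<le> (LINT s:{a..b}|lebesgue. N)"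
      by (rule set_integral_mono_AE) (use ae int const in \<open>auto intro: set_integrable_abs\<close>)
    then show ?thesis
      using int True by (simp add: const_int dual_interval_norm_def N_def)
  next
    case False
    define r where "r = enn2real p"
    have r: "1 \<le> r"
      using one_le_enn2real[OF p False] by (simp add: r_def)
    define J where "J = (\<integral>\<^sup>+ t. ennreal (\<bar>x t\<bar> powr r) \<partial>lebesgue)"
    define j where "j = enn2real J"
    have Jfin: "J < \<infinity>"
      using x False by (auto simp: Lp_def Lp_norm_def J_def r_def Let_def less_top split: if_splits)
    then have norm: "enn2real (Lp_norm p x) = j powr (1 / r)"
      using False by (simp add: Lp_norm_def J_def r_def j_def Let_def)
    have pow: "integrable lebesgue (\<lambda>t. \<bar>x t\<bar> powr r)"
      using Jfin by (intro integrableI_nonneg) (auto simp: J_def)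
    have "ennreal (LINT t|lebesgue. \<bar>x t\<bar> powr r) = J"
      using nn_integral_eq_integral[OF pow] by (simp add: J_def)
    moreover have "0 \<le> (LINT t|lebesgue. \<bar>x t\<bar> powr r)"
      by (rule integral_nonneg_AE) simp
    ultimately have j: "(LINT t|lebesgue. \<bar>x t\<bar> powr r) = j"
      unfolding j_def by (metis enn2real_ennreal)
    have "0 \<le> j"
      by (simp add: j_def)
    have powS: "set_integrable lebesgue {a..b} (\<lambda>t. \<bar>x t\<bar> powr r)"
      unfolding set_integrable_def by (rule integrable_mult_indicator[OF _ pow]) simp
    have powS_le: "(LINT t:{a..b}|lebesgue. \<bar>x t\<bar> powr r) \<le> j"
      unfolding j[symmetric] set_lebesgue_integral_def
      by (rule integral_mono[OF powS[unfolded set_integrable_def] pow])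
        (auto simp: indicator_def)
    have rhs: "set_integrable lebesgue {a..b}
        (\<lambda>t. (1 / r) * m powr (1 - r) * \<bar>x t\<bar> powr r + (1 - 1 / r) * m)" for m
      by (intro set_integral_add set_integrable_mult_right powS const)
    have int: "set_integrable lebesgue {a..b} x"
      by (rule set_integrable_bound[OF rhs[of 1] sbm])
        (use tangent_powr[OF r, of "\<bar>x _\<bar>" 1] in \<open>auto intro!: order_trans[OF _ abs_ge_self]\<close>)
    define L where "L = b - a"
    have "0 < L"
      using \<open>a < b\<close> by (simp add: L_def)
    have bound: "(LINT s:{a..b}|lebesgue. \<bar>x s\<bar>) \<le> (1 / r) * m powr (1 - r) * j + (1 - 1 / r) * m * L"
      if "0 < m" for m
    proof -
      have "(LINT s:{a..b}|lebesgue. \<bar>x s\<bar>)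
          \<le> (LINT t:{a..b}|lebesgue. (1 / r) * m powr (1 - r) * \<bar>x t\<bar> powr r + (1 - 1 / r) * m)"
        by (rule set_integral_mono[OF set_integrable_abs[OF int] rhs])
          (use tangent_powr[OF r _ that] in auto)
      also have "\<dots> = (1 / r) * m powr (1 - r) * (LINT t:{a..b}|lebesgue. \<bar>x t\<bar> powr r)
          + (1 - 1 / r) * m * L"
        by (subst set_integral_add(2))
          (intro set_integrable_mult_right powS const, rule const,
           simp add: const_int L_def)
      also have "\<dots> \<le> (1 / r) * m powr (1 - r) * j + (1 - 1 / r) * m * L"
        using powS_le r by (intro add_right_mono mult_left_mono) auto
      finally show ?thesis .
    qed
    have "(LINT s:{a..b}|lebesgue. \<bar>x s\<bar>) \<le> L powr (1 - 1 / r) * j powr (1 / r)"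
    proof (cases "j = 0")
      case True
      have "(LINT s:{a..b}|lebesgue. \<bar>x s\<bar>) \<le> 0 + e" if "0 < e" for e
      proof -
        have "(LINT s:{a..b}|lebesgue. \<bar>x s\<bar>) \<le> (1 - 1 / r) * (e / L) * L"
          using bound[of "e / L"] that \<open>0 < L\<close> True by simp
        also have "\<dots> \<le> e"
          using that \<open>0 < L\<close> r by (simp add: field_simps)
        finally show ?thesis by simp
      qed
      then have "(LINT s:{a..b}|lebesgue. \<bar>x s\<bar>) \<le> 0"
        by (rule field_le_epsilon)
      then show ?thesis
        using True by simp
    next
      case False
      then have "0 < j"
        using \<open>0 \<le> j\<close> by simp
      define m where "m = (j / L) powr (1 / r)"
      have "0 < m"
        using \<open>0 < j\<close> \<open>0 < L\<close> by (simp add: m_def)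
      have mr: "m powr r = j / L"
        using r \<open>0 < j\<close> \<open>0 < L\<close> by (simp add: m_def powr_powr)
      have "m powr (1 - r) * j = m * L"
        using mr \<open>0 < m\<close> \<open>0 < j\<close> \<open>0 < L\<close> by (simp add: powr_diff)
      then have "(LINT s:{a..b}|lebesgue. \<bar>x s\<bar>) \<le> (1 / r) * (m * L) + (1 - 1 / r) * m * L"
        using bound[OF \<open>0 < m\<close>] by (simp add: mult.assoc)
      also have "\<dots> = L * m"
        by (simp add: algebra_simps)
      also have "\<dots> = L powr (1 - 1 / r) * j powr (1 / r)"
        using \<open>0 < L\<close> \<open>0 < j\<close> by (simp add: m_def powr_divide powr_diff)
      finally show ?thesis .
    qed
    then show ?thesis
      using int False by (simp add: norm dual_interval_norm_def r_def L_def)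
  qed
  then show "set_integrable lebesgue {a..b} x"
    and "(LINT s:{a..b}|lebesgue. \<bar>x s\<bar>) \<le> dual_interval_norm p (b - a) * enn2real (Lp_norm p x)"
    by auto
qed

lemma set_integrable_bounded_mult:
  fixes \<phi> x :: "real \<Rightarrow> real"
  assumes x: "set_integrable lebesgue {a..b} x" and "x \<in> borel_measurable lebesgue"
    and "\<phi> \<in> borel_measurable lebesgue" and le: "\<And>s. \<bar>\<phi> s\<bar> \<le> 1"
  shows "set_integrable lebesgue {a..b} (\<lambda>s. \<phi> s * x s)"
    and "\<bar>LINT s:{a..b}|lebesgue. \<phi> s * x s\<bar> \<le> (LINT s:{a..b}|lebesgue. \<bar>x s\<bar>)"
proof -
  have [measurable]: "x \<in> borel_measurable lebesgue" "\<phi> \<in> borel_measurable lebesgue"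
    by fact+
  have le': "\<bar>\<phi> s * x s\<bar> \<le> \<bar>x s\<bar>" for s
    using mult_right_mono[OF le[of s], of "\<bar>x s\<bar>"] by (simp add: abs_mult)
  show int: "set_integrable lebesgue {a..b} (\<lambda>s. \<phi> s * x s)"
  proof (rule set_integrable_bound[OF x])
    show "set_borel_measurable lebesgue {a..b} (\<lambda>s. \<phi> s * x s)"
      unfolding set_borel_measurable_def
      by (intro borel_measurable_scaleR borel_measurable_times borel_measurable_indicator) auto
  qed (use le' in auto)
  have "\<bar>LINT s:{a..b}|lebesgue. \<phi> s * x s\<bar> \<le> (LINT s:{a..b}|lebesgue. \<bar>\<phi> s * x s\<bar>)"
    using set_integral_norm_bound[OF int] by simp
  also have "\<dots> \<le> (LINT s:{a..b}|lebesgue. \<bar>x s\<bar>)"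
    by (rule set_integral_mono) (use int x le' in \<open>auto intro: set_integrable_abs\<close>)
  finally show "\<bar>LINT s:{a..b}|lebesgue. \<phi> s * x s\<bar> \<le> (LINT s:{a..b}|lebesgue. \<bar>x s\<bar>)" .
qed

section \<open>Rank-one operators\<close>

text \<open>
  The number \<open>F\<close> is the value at \<open>x\<close> of a functional. Both factors are estimated with sharp
  constants, so that their product is exactly \<open>lambda_tilde\<close> (\<open>lambda_tilde_eq\<close>).
\<close>

lemma Lp_norm_rank_one_le:
  assumes p: "1 \<le> p" and x: "x \<in> Lp p" and "a < b" "\<alpha> \<le> \<beta>"
    and F: "\<bar>F\<bar> \<le> (LINT s:{a..b}|lebesgue. \<bar>x s\<bar>)"
    and g: "g \<in> borel_measurable lebesgue" and g_le: "\<And>t. \<bar>g t\<bar> \<le> indicator {\<alpha>..\<beta>} t"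
  shows "Lp_norm p (\<lambda>t. c * F * g t)
    \<le> ennreal (\<bar>c\<bar> * (interval_norm p (\<beta> - \<alpha>) * dual_interval_norm p (b - a)) * enn2real (Lp_norm p x))"
proof -
  have "Lp_norm p (\<lambda>t. c * F * g t) \<le> ennreal (\<bar>c * F\<bar> * interval_norm p (\<beta> - \<alpha>))"
  proof (rule Lp_norm_le_of_interval_support[OF p \<open>\<alpha> \<le> \<beta>\<close> abs_ge_zero])
    show "(\<lambda>t. c * F * g t) \<in> borel_measurable lebesgue"
      by (intro borel_measurable_times borel_measurable_const g)
    show "\<bar>c * F * g t\<bar> \<le> \<bar>c * F\<bar> * indicator {\<alpha>..\<beta>} t" for t
      unfolding abs_mult[of "c * F"] by (intro mult_left_mono g_le abs_ge_zero)
  qed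
  also have "\<dots> \<le> ennreal (\<bar>c\<bar> * (dual_interval_norm p (b - a) * enn2real (Lp_norm p x))
      * interval_norm p (\<beta> - \<alpha>))"
    unfolding abs_mult
    using order_trans[OF F Lp_set_integrable_and_Holder(2)[OF p x \<open>a < b\<close>]]
    by (intro ennreal_leI mult_right_mono mult_left_mono) (simp_all add: interval_norm_nonneg)
  finally show ?thesis
    by (simp add: mult_ac)
qed

lemma tendsto_zero_of_le_ennreal_mult:
  fixes f :: "'a \<Rightarrow> ennreal" and g :: "'a \<Rightarrow> real"
  assumes "eventually (\<lambda>v. f v \<le> ennreal (\<bar>g v\<bar> * K)) F" "(g \<longlongrightarrow> 0) F"
  shows "(f \<longlongrightarrow> 0) F"
proof (rule tendsto_sandwich[OF _ assms(1) tendsto_const])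
  show "((\<lambda>v. ennreal (\<bar>g v\<bar> * K)) \<longlongrightarrow> 0) F"
    using tendsto_ennrealI[OF tendsto_mult_right[OF tendsto_rabs[OF assms(2)], of K]] by simp
qed simp

lemma op_diff_zero: "op_diff T op_zero = T"
  by (simp add: op_diff_def op_zero_def)

lemma tends_in_norm_of_rank_one:
  assumes p: "1 \<le> p" and "a < b" "\<alpha> \<le> \<beta>"
    and diff: "\<And>n x. x \<in> Lp p \<Longrightarrow> op_diff (T n) S x = (\<lambda>t. c n * F x * g t)"
    and F: "\<And>x. x \<in> Lp p \<Longrightarrow> \<bar>F x\<bar> \<le> (LINT s:{a..b}|lebesgue. \<bar>x s\<bar>)"
    and g: "g \<in> borel_measurable lebesgue" "\<And>t. \<bar>g t\<bar> \<le> indicator {\<alpha>..\<beta>} t"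
    and c: "c \<longlonglongrightarrow> 0"
  shows "tends_in_norm p T S"
proof -
  define K where "K = interval_norm p (\<beta> - \<alpha>) * dual_interval_norm p (b - a)"
  have "0 \<le> K"
    using \<open>a < b\<close> by (simp add: K_def interval_norm_nonneg dual_interval_norm_nonneg)
  have "op_norm p (op_diff (T n) S) \<le> ennreal (\<bar>c n\<bar> * K)" for n
    unfolding op_norm_def
  proof (rule SUP_least)
    fix x assume "x \<in> {x \<in> Lp p. Lp_norm p x \<le> 1}"
    then have x: "x \<in> Lp p" and "Lp_norm p x \<le> 1"
      by auto
    have "enn2real (Lp_norm p x) \<le> 1"
      using enn2real_mono[OF \<open>Lp_norm p x \<le> 1\<close>] by simp
    then have "\<bar>c n\<bar> * K * enn2real (Lp_norm p x) \<le> \<bar>c n\<bar> * K"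
      using \<open>0 \<le> K\<close> by (intro mult_left_le) simp_all
    then have "ennreal (\<bar>c n\<bar> * K * enn2real (Lp_norm p x)) \<le> ennreal (\<bar>c n\<bar> * K)"
      by (rule ennreal_leI)
    with Lp_norm_rank_one_le[OF p x \<open>a < b\<close> \<open>\<alpha> \<le> \<beta>\<close> F[OF x] g, of "c n"]
    show "Lp_norm p (op_diff (T n) S x) \<le> ennreal (\<bar>c n\<bar> * K)"
      unfolding diff[OF x] K_def[symmetric] by (rule order_trans)
  qed
  then show ?thesis
    unfolding tends_in_norm_def
    by (intro tendsto_zero_of_le_ennreal_mult[OF always_eventually c] allI)
qed

section \<open>The trigonometric operators\<close>

definition cos_moment :: "real \<Rightarrow> real \<Rightarrow> real \<Rightarrow> (real \<Rightarrow> real) \<Rightarrow> real" where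
  "cos_moment a b \<omega> x = (LINT s:{a..b}|lebesgue. cos (\<omega> * s) * x s)"

definition sin_moment :: "real \<Rightarrow> real \<Rightarrow> real \<Rightarrow> (real \<Rightarrow> real) \<Rightarrow> real" where
  "sin_moment a b \<omega> x = (LINT s:{a..b}|lebesgue. sin (\<omega> * s) * x s)"

definition cos_window :: "real \<Rightarrow> real \<Rightarrow> real \<Rightarrow> real \<Rightarrow> real" where
  "cos_window \<alpha> \<beta> \<omega> t = indicator {\<alpha>..\<beta>} t * cos (\<omega> * t)"

definition sin_window :: "real \<Rightarrow> real \<Rightarrow> real \<Rightarrow> real \<Rightarrow> real" where
  "sin_window \<alpha> \<beta> \<omega> t = indicator {\<alpha>..\<beta>} t * sin (\<omega> * t)"

lemma cos_sin_lebesgue_measurable [measurable]: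
  "(\<lambda>t. cos (\<omega> * t)) \<in> borel_measurable lebesgue"
  "(\<lambda>t. sin (\<omega> * t)) \<in> borel_measurable lebesgue"
  for \<omega> :: real
  by (auto intro!: measurable_completion)

lemma window_measurable [measurable]:
  "cos_window \<alpha> \<beta> \<omega> \<in> borel_measurable lebesgue" "sin_window \<alpha> \<beta> \<omega> \<in> borel_measurable lebesgue"
  unfolding cos_window_def[abs_def] sin_window_def[abs_def]
  by (intro borel_measurable_times borel_measurable_indicator cos_sin_lebesgue_measurable; simp)+

lemma window_le:
  "\<bar>cos_window \<alpha> \<beta> \<omega> t\<bar> \<le> indicator {\<alpha>..\<beta>} t" "\<bar>sin_window \<alpha> \<beta> \<omega> t\<bar> \<le> indicator {\<alpha>..\<beta>} t"
  by (auto simp: cos_window_def sin_window_def indicator_def)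

lemma
  assumes "1 \<le> p" "x \<in> Lp p" "a < b"
  shows cos_moment_integrable: "set_integrable lebesgue {a..b} (\<lambda>s. cos (\<omega> * s) * x s)"
    and sin_moment_integrable: "set_integrable lebesgue {a..b} (\<lambda>s. sin (\<omega> * s) * x s)"
    and cos_moment_le: "\<bar>cos_moment a b \<omega> x\<bar> \<le> (LINT s:{a..b}|lebesgue. \<bar>x s\<bar>)"
    and sin_moment_le: "\<bar>sin_moment a b \<omega> x\<bar> \<le> (LINT s:{a..b}|lebesgue. \<bar>x s\<bar>)"
  unfolding cos_moment_def sin_moment_def
  using Lp_set_integrable_and_Holder(1)[OF assms] assms(2)
  by (auto intro!: set_integrable_bounded_mult simp: Lp_def)

lemma moment_cong_AE:
  assumes "x \<in> Lp p" "y \<in> Lp p" "AE t in lebesgue. x t = y t"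
  shows "cos_moment a b \<omega> x = cos_moment a b \<omega> y" "sin_moment a b \<omega> x = sin_moment a b \<omega> y"
proof -
  have "(LINT s:{a..b}|lebesgue. \<phi> s * x s) = (LINT s:{a..b}|lebesgue. \<phi> s * y s)"
    if "\<phi> \<in> borel_measurable lebesgue" for \<phi> :: "real \<Rightarrow> real"
    unfolding set_lebesgue_integral_def
  proof (rule integral_cong_AE)
    show "(\<lambda>s. indicator {a..b} s *\<^sub>R (\<phi> s * x s)) \<in> borel_measurable lebesgue"
      "(\<lambda>s. indicator {a..b} s *\<^sub>R (\<phi> s * y s)) \<in> borel_measurable lebesgue"
      using assms that
      by (auto simp: Lp_def
          intro!: borel_measurable_scaleR borel_measurable_times borel_measurable_indicator)
    show "AE s in lebesgue. indicator {a..b} s *\<^sub>R (\<phi> s * x s) = indicator {a..b} s *\<^sub>R (\<phi> s * y s)"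
      using assms(3) by eventually_elim simp
  qed
  then show "cos_moment a b \<omega> x = cos_moment a b \<omega> y" "sin_moment a b \<omega> x = sin_moment a b \<omega> y"
    unfolding cos_moment_def sin_moment_def by (simp_all add: cos_sin_lebesgue_measurable)
qed

lemma opB_eq: "opB \<alpha> \<beta> a b \<omega> \<theta> x = (\<lambda>t. \<theta> * cos_moment a b \<omega> x * cos_window \<alpha> \<beta> \<omega> t)"
proof
  fix t
  have "opB \<alpha> \<beta> a b \<omega> \<theta> x t
      = (LINT s:{a..b}|lebesgue. (\<theta> * cos_window \<alpha> \<beta> \<omega> t) * (cos (\<omega> * s) * x s))"
    unfolding opB_def by (rule set_lebesgue_integral_cong) (auto simp: cos_window_def)
  then show "opB \<alpha> \<beta> a b \<omega> \<theta> x t = \<theta> * cos_moment a b \<omega> x * cos_window \<alpha> \<beta> \<omega> t"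
    by (simp add: cos_moment_def)
qed

text \<open>
  Splitting the integral of the kernel needs both moments to exist, hence \<open>x \<in> Lp p\<close>.
\<close>

lemma opA_eq:
  assumes "1 \<le> p" "x \<in> Lp p" "a < b"
  shows "opA \<alpha> \<beta> a b \<sigma>\<^sub>1 \<sigma>\<^sub>2 \<delta> \<omega> \<theta> x =
    (\<lambda>t. (cos_moment a b \<omega> x / (\<delta> * \<sigma>\<^sub>2) + \<theta> * sin_moment a b \<omega> x) * cos_window \<alpha> \<beta> \<omega> t
       + - (sin_moment a b \<omega> x / (\<delta> * \<sigma>\<^sub>1)) * sin_window \<alpha> \<beta> \<omega> t)"
proof
  fix t
  let ?u = "1 / (\<delta> * \<sigma>\<^sub>2) * cos_window \<alpha> \<beta> \<omega> t"
  let ?v = "\<theta> * cos_window \<alpha> \<beta> \<omega> t - 1 / (\<delta> * \<sigma>\<^sub>1) * sin_window \<alpha> \<beta> \<omega> t"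
  have "opA \<alpha> \<beta> a b \<sigma>\<^sub>1 \<sigma>\<^sub>2 \<delta> \<omega> \<theta> x t
      = (LINT s:{a..b}|lebesgue. ?u * (cos (\<omega> * s) * x s) + ?v * (sin (\<omega> * s) * x s))"
    unfolding opA_def
    by (rule set_lebesgue_integral_cong)
      (auto simp: cos_window_def sin_window_def algebra_simps)
  also have "\<dots> = ?u * cos_moment a b \<omega> x + ?v * sin_moment a b \<omega> x"
    unfolding cos_moment_def sin_moment_def
    by (subst set_integral_add(2))
      (use cos_moment_integrable[OF assms] sin_moment_integrable[OF assms] in auto)
  finally show "opA \<alpha> \<beta> a b \<sigma>\<^sub>1 \<sigma>\<^sub>2 \<delta> \<omega> \<theta> x t =
    (cos_moment a b \<omega> x / (\<delta> * \<sigma>\<^sub>2) + \<theta> * sin_moment a b \<omega> x) * cos_window \<alpha> \<beta> \<omega> t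
       + - (sin_moment a b \<omega> x / (\<delta> * \<sigma>\<^sub>1)) * sin_window \<alpha> \<beta> \<omega> t"
    by (simp add: algebra_simps)
qed

lemma opA_lim_eq_opA_0: "opA_lim \<alpha> \<beta> a b \<sigma>\<^sub>1 \<sigma>\<^sub>2 \<delta> \<omega> = opA \<alpha> \<beta> a b \<sigma>\<^sub>1 \<sigma>\<^sub>2 \<delta> \<omega> 0"
  by (simp add: opA_lim_def opA_def)

lemma window_combination_in_Lp:
  assumes "1 \<le> p" "\<alpha> \<le> \<beta>"
  shows "(\<lambda>t. u * cos_window \<alpha> \<beta> \<omega> t + v * sin_window \<alpha> \<beta> \<omega> t) \<in> Lp p"
proof -
  have meas: "(\<lambda>t. u * cos_window \<alpha> \<beta> \<omega> t + v * sin_window \<alpha> \<beta> \<omega> t) \<in> borel_measurable lebesgue"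
    by (intro borel_measurable_add borel_measurable_times borel_measurable_const window_measurable)
  moreover
  have "\<bar>u * cos_window \<alpha> \<beta> \<omega> t + v * sin_window \<alpha> \<beta> \<omega> t\<bar> \<le> (\<bar>u\<bar> + \<bar>v\<bar>) * indicator {\<alpha>..\<beta>} t" for t
  proof -
    have "\<bar>u * cos_window \<alpha> \<beta> \<omega> t\<bar> \<le> \<bar>u\<bar> * indicator {\<alpha>..\<beta>} t"
      "\<bar>v * sin_window \<alpha> \<beta> \<omega> t\<bar> \<le> \<bar>v\<bar> * indicator {\<alpha>..\<beta>} t"
      unfolding abs_mult by (intro mult_left_mono window_le abs_ge_zero)+
    then show ?thesis
      unfolding distrib_right by linarith
  qed
  ultimately have "Lp_norm p (\<lambda>t. u * cos_window \<alpha> \<beta> \<omega> t + v * sin_window \<alpha> \<beta> \<omega> t)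
      \<le> ennreal ((\<bar>u\<bar> + \<bar>v\<bar>) * interval_norm p (\<beta> - \<alpha>))"
    by (intro Lp_norm_le_of_interval_support assms) simp_all
  also have "\<dots> < \<infinity>" by simp
  finally show ?thesis
    using meas by (simp add: Lp_def)
qed

lemma Lp_operator_opB:
  assumes "1 \<le> p" "\<alpha> \<le> \<beta>"
  shows "Lp_operator p (opB \<alpha> \<beta> a b \<omega> \<theta>)"
  unfolding Lp_operator_def opB_eq
proof (intro conjI ballI impI)
  show "(\<lambda>t. \<theta> * cos_moment a b \<omega> x * cos_window \<alpha> \<beta> \<omega> t) \<in> Lp p" for x
    using window_combination_in_Lp[OF assms, of "\<theta> * cos_moment a b \<omega> x" \<omega> 0] by simp
  fix x y assume "x \<in> Lp p" "y \<in> Lp p" "AE t in lebesgue. x t = y t"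
  from moment_cong_AE(1)[OF this]
  show "AE t in lebesgue. \<theta> * cos_moment a b \<omega> x * cos_window \<alpha> \<beta> \<omega> t
      = \<theta> * cos_moment a b \<omega> y * cos_window \<alpha> \<beta> \<omega> t" by simp
qed

lemma Lp_operator_opA:
  assumes "1 \<le> p" "\<alpha> \<le> \<beta>" "a < b"
  shows "Lp_operator p (opA \<alpha> \<beta> a b \<sigma>\<^sub>1 \<sigma>\<^sub>2 \<delta> \<omega> \<theta>)"
  unfolding Lp_operator_def
proof (intro conjI ballI impI)
  fix x assume x: "x \<in> Lp p"
  show "opA \<alpha> \<beta> a b \<sigma>\<^sub>1 \<sigma>\<^sub>2 \<delta> \<omega> \<theta> x \<in> Lp p"
    unfolding opA_eq[OF assms(1) x assms(3)] by (rule window_combination_in_Lp[OF assms(1,2)])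
  fix y assume y: "y \<in> Lp p" and xy: "AE t in lebesgue. x t = y t"
  show "AE t in lebesgue. opA \<alpha> \<beta> a b \<sigma>\<^sub>1 \<sigma>\<^sub>2 \<delta> \<omega> \<theta> x t = opA \<alpha> \<beta> a b \<sigma>\<^sub>1 \<sigma>\<^sub>2 \<delta> \<omega> \<theta> y t"
    unfolding opA_eq[OF assms(1) x assms(3)] opA_eq[OF assms(1) y assms(3)]
      moment_cong_AE[OF x y xy] by simp
qed

section \<open>Orthogonality and the commutation relations\<close>

text \<open>
  Orthogonality itself is assumed here, and not the integrality condition on \<open>\<omega>\<close>, because it is
  what the parameter set prescribes; so the same computations serve fixed and varying parameters.
\<close>

locale orthogonal_trig =
  fixes p :: ennreal and \<alpha> \<beta> \<alpha>\<^sub>1 \<beta>\<^sub>1 \<sigma>\<^sub>1 \<sigma>\<^sub>2 \<delta> \<omega> :: real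
  assumes p: "1 \<le> p" and \<delta>: "\<delta> \<noteq> 0"
    and bounds: "\<alpha>\<^sub>1 < \<beta>\<^sub>1" "\<alpha> \<le> \<alpha>\<^sub>1" "\<beta>\<^sub>1 \<le> \<beta>"
    and orth: "(LINT s:{\<alpha>\<^sub>1..\<beta>\<^sub>1}|lebesgue. sin (\<omega> * s) * cos (\<omega> * s)) = 0"
    and \<sigma>\<^sub>1: "\<sigma>\<^sub>1 = (LINT s:{\<alpha>\<^sub>1..\<beta>\<^sub>1}|lebesgue. (sin (\<omega> * s))\<^sup>2)" "\<sigma>\<^sub>1 \<noteq> 0"
    and \<sigma>\<^sub>2: "\<sigma>\<^sub>2 = (LINT s:{\<alpha>\<^sub>1..\<beta>\<^sub>1}|lebesgue. (cos (\<omega> * s))\<^sup>2)" "\<sigma>\<^sub>2 \<noteq> 0"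
begin

abbreviation "\<A> \<equiv> opA \<alpha> \<beta> \<alpha>\<^sub>1 \<beta>\<^sub>1 \<sigma>\<^sub>1 \<sigma>\<^sub>2 \<delta> \<omega>"
abbreviation "\<B> \<equiv> opB \<alpha> \<beta> \<alpha>\<^sub>1 \<beta>\<^sub>1 \<omega>"
abbreviation "C \<equiv> cos_moment \<alpha>\<^sub>1 \<beta>\<^sub>1 \<omega>"
abbreviation "S \<equiv> sin_moment \<alpha>\<^sub>1 \<beta>\<^sub>1 \<omega>"
abbreviation "cw \<equiv> cos_window \<alpha> \<beta> \<omega>"
abbreviation "sw \<equiv> sin_window \<alpha> \<beta> \<omega>"

text \<open>
  The moments integrate over \<open>[\<alpha>\<^sub>1, \<beta>\<^sub>1]\<close> only, where the windows agree with cosine and sine; the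
  mixed terms vanish by orthogonality.
\<close>

lemma moment_window_combination:
  "C (\<lambda>t. u * cw t + v * sw t) = u * \<sigma>\<^sub>2" "S (\<lambda>t. u * cw t + v * sw t) = v * \<sigma>\<^sub>1"
proof -
  have int: "set_integrable lebesgue {\<alpha>\<^sub>1..\<beta>\<^sub>1} (\<lambda>s. (cos (\<omega> * s))\<^sup>2)"
    "set_integrable lebesgue {\<alpha>\<^sub>1..\<beta>\<^sub>1} (\<lambda>s. (sin (\<omega> * s))\<^sup>2)"
    "set_integrable lebesgue {\<alpha>\<^sub>1..\<beta>\<^sub>1} (\<lambda>s. sin (\<omega> * s) * cos (\<omega> * s))"
    by (intro absolutely_integrable_continuous_real continuous_intros)+
  have "C (\<lambda>t. u * cw t + v * sw t)
      = (LINT s:{\<alpha>\<^sub>1..\<beta>\<^sub>1}|lebesgue. u * (cos (\<omega> * s))\<^sup>2 + v * (sin (\<omega> * s) * cos (\<omega> * s)))"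
    unfolding cos_moment_def using bounds
    by (intro set_lebesgue_integral_cong)
      (auto simp: cos_window_def sin_window_def power2_eq_square algebra_simps)
  then show "C (\<lambda>t. u * cw t + v * sw t) = u * \<sigma>\<^sub>2"
    by (subst (asm) set_integral_add(2)) (use int orth \<sigma>\<^sub>2 in auto)
  have "S (\<lambda>t. u * cw t + v * sw t)
      = (LINT s:{\<alpha>\<^sub>1..\<beta>\<^sub>1}|lebesgue. u * (sin (\<omega> * s) * cos (\<omega> * s)) + v * (sin (\<omega> * s))\<^sup>2)"
    unfolding sin_moment_def using bounds
    by (intro set_lebesgue_integral_cong)
      (auto simp: cos_window_def sin_window_def power2_eq_square algebra_simps)
  then show "S (\<lambda>t. u * cw t + v * sw t) = v * \<sigma>\<^sub>1"
    by (subst (asm) set_integral_add(2)) (use int orth \<sigma>\<^sub>1 in auto)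
qed

lemma A_in_Lp: "x \<in> Lp p \<Longrightarrow> \<A> \<theta> x \<in> Lp p"
  and B_in_Lp: "x \<in> Lp p \<Longrightarrow> \<B> \<theta> x \<in> Lp p"
  using Lp_operator_opA[of p \<alpha> \<beta> \<alpha>\<^sub>1 \<beta>\<^sub>1] Lp_operator_opB[of p \<alpha> \<beta>] p bounds
  by (auto simp: Lp_operator_def)

text \<open>
  The triangular matrix of \<open>A\<close> on the pair of moments. Its eigenvalues are \<open>1 / \<delta>\<close> and
  \<open>- 1 / \<delta>\<close>, so its square is scalar; this makes \<open>\<theta>\<close> disappear from \<open>B_A_A_eq\<close> below.
\<close>

lemma moments_A:
  assumes "x \<in> Lp p"
  shows "C (\<A> \<theta> x) = C x / \<delta> + \<theta> * \<sigma>\<^sub>2 * S x" "S (\<A> \<theta> x) = - S x / \<delta>"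
  unfolding opA_eq[OF p assms bounds(1)] moment_window_combination
  using \<sigma>\<^sub>1(2) \<sigma>\<^sub>2(2) \<delta> by (auto simp: field_simps)

lemma moments_B: "C (\<B> \<eta> x) = \<eta> * \<sigma>\<^sub>2 * C x" "S (\<B> \<eta> x) = 0"
  using moment_window_combination[of "\<eta> * C x" 0] by (simp_all add: opB_eq mult_ac)

lemma A_B_eq:
  assumes "x \<in> Lp p"
  shows "\<A> \<theta> (\<B> \<eta> x) = (\<lambda>t. \<eta> * C x / \<delta> * cw t)"
  unfolding opA_eq[OF p B_in_Lp[OF assms] bounds(1)] moments_B
  using \<sigma>\<^sub>2(2) by simp

lemma B_A_A_eq:
  assumes "x \<in> Lp p"
  shows "\<B> \<eta> (\<A> \<theta> (\<A> \<theta> x)) = (\<lambda>t. \<eta> * C x / \<delta>\<^sup>2 * cw t)"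
  unfolding opB_eq moments_A[OF A_in_Lp[OF assms]] moments_A[OF assms]
  using \<delta> by (simp add: power2_eq_square add_divide_distrib)

lemma commutation_relation: "op_eq p (\<A> \<theta> \<circ> \<B> \<eta>) (op_scale \<delta> (\<B> \<eta> \<circ> \<A> \<theta> \<circ> \<A> \<theta>))"
  using \<delta> by (simp add: op_eq_def op_scale_def A_B_eq B_A_A_eq power2_eq_square)

lemma commutator_eq:
  assumes "x \<in> Lp p"
  shows "op_diff (\<A> \<theta> \<circ> \<B> \<eta>) (\<B> \<eta> \<circ> \<A> \<theta>) x = (\<lambda>t. - \<theta> * \<sigma>\<^sub>2 * \<eta> * S x * cw t)"
  unfolding op_diff_def comp_def A_B_eq[OF assms]
  by (simp add: opB_eq moments_A[OF assms] algebra_simps)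

lemma commutator_integral:
  assumes "x \<in> Lp p"
  shows "op_diff (\<A> \<theta> \<circ> \<B> \<eta>) (\<B> \<eta> \<circ> \<A> \<theta>) x t = - \<theta> * \<sigma>\<^sub>2 * \<eta> *
    (LINT s:{\<alpha>\<^sub>1..\<beta>\<^sub>1}|lebesgue. indicator {\<alpha>..\<beta>} t * cos (\<omega> * t) * sin (\<omega> * s) * x s)"
proof -
  have "(LINT s:{\<alpha>\<^sub>1..\<beta>\<^sub>1}|lebesgue. indicator {\<alpha>..\<beta>} t * cos (\<omega> * t) * sin (\<omega> * s) * x s)
      = cw t * S x"
    by (simp add: cos_window_def sin_moment_def mult.assoc)
  then show ?thesis
    by (simp add: commutator_eq[OF assms])
qed

lemma commutator_tends_to_zero:
  assumes "(\<lambda>n. \<theta> n * \<eta> n) \<longlonglongrightarrow> 0"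
  shows "tends_in_norm p (\<lambda>n. op_diff (\<A> (\<theta> n) \<circ> \<B> (\<eta> n)) (\<B> (\<eta> n) \<circ> \<A> (\<theta> n))) op_zero"
proof (rule tends_in_norm_of_rank_one[where \<alpha> = \<alpha> and \<beta> = \<beta> and F = S and g = cw
      and c = "\<lambda>n. - \<sigma>\<^sub>2 * (\<theta> n * \<eta> n)"])
  show "op_diff (op_diff (\<A> (\<theta> n) \<circ> \<B> (\<eta> n)) (\<B> (\<eta> n) \<circ> \<A> (\<theta> n))) op_zero x
    = (\<lambda>t. - \<sigma>\<^sub>2 * (\<theta> n * \<eta> n) * S x * cw t)" if "x \<in> Lp p" for n x
    unfolding op_diff_zero commutator_eq[OF that] by (simp add: mult_ac)
  show "(\<lambda>n. - \<sigma>\<^sub>2 * (\<theta> n * \<eta> n)) \<longlonglongrightarrow> 0"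
    using tendsto_mult_left[OF assms, of "- \<sigma>\<^sub>2"] by simp
  show "\<bar>S x\<bar> \<le> (LINT s:{\<alpha>\<^sub>1..\<beta>\<^sub>1}|lebesgue. \<bar>x s\<bar>)" if "x \<in> Lp p" for x
    using sin_moment_le p that bounds by blast
qed (use p bounds window_le in auto)

lemma A_tends_in_norm:
  assumes "\<theta> \<longlonglongrightarrow> \<theta>'"
  shows "tends_in_norm p (\<lambda>n. \<A> (\<theta> n)) (\<A> \<theta>')"
proof (rule tends_in_norm_of_rank_one[where \<alpha> = \<alpha> and \<beta> = \<beta> and F = S and g = cw and c = "\<lambda>n. \<theta> n - \<theta>'"])
  show "op_diff (\<A> (\<theta> n)) (\<A> \<theta>') x = (\<lambda>t. (\<theta> n - \<theta>') * S x * cw t)" if "x \<in> Lp p" for n x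
    unfolding op_diff_def opA_eq[OF p that bounds(1)] by (simp add: algebra_simps)
  show "(\<lambda>n. \<theta> n - \<theta>') \<longlonglongrightarrow> 0"
    using assms by (simp add: LIM_zero)
  show "\<bar>S x\<bar> \<le> (LINT s:{\<alpha>\<^sub>1..\<beta>\<^sub>1}|lebesgue. \<bar>x s\<bar>)" if "x \<in> Lp p" for x
    using sin_moment_le p that bounds by blast
qed (use p bounds window_le in auto)

lemma B_tends_in_norm:
  assumes "\<eta> \<longlonglongrightarrow> 0"
  shows "tends_in_norm p (\<lambda>n. \<B> (\<eta> n)) op_zero"
proof (rule tends_in_norm_of_rank_one[where \<alpha> = \<alpha> and \<beta> = \<beta> and F = C and g = cw and c = \<eta>])
  show "op_diff (\<B> (\<eta> n)) op_zero x = (\<lambda>t. \<eta> n * C x * cw t)" for n x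
    by (simp add: op_diff_zero opB_eq)
  show "\<bar>C x\<bar> \<le> (LINT s:{\<alpha>\<^sub>1..\<beta>\<^sub>1}|lebesgue. \<bar>x s\<bar>)" if "x \<in> Lp p" for x
    using cos_moment_le p that bounds by blast
qed (use p bounds window_le assms in auto)

lemma A_0_B_commute: "op_eq p (\<A> 0 \<circ> \<B> \<eta>) (\<B> \<eta> \<circ> \<A> 0)"
  unfolding op_eq_def
proof
  fix x assume "x \<in> Lp p"
  from commutator_eq[OF this, of 0 \<eta>]
  show "AE t in lebesgue. (\<A> 0 \<circ> \<B> \<eta>) x t = (\<B> \<eta> \<circ> \<A> 0) x t"
    by (auto simp: op_diff_def fun_eq_iff)
qed

text \<open>
  The right-hand side involves the parameters only through the quantity that tends to zero in the
  last claim of the theorem, with no constant depending on the intervals or on \<open>\<omega>\<close>.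
\<close>

lemma Lp_norm_commutator_le:
  assumes "x \<in> Lp p"
  shows "Lp_norm p (op_diff (\<A> \<theta> \<circ> \<B> \<eta>) (\<B> \<eta> \<circ> \<A> \<theta>) x)
    \<le> ennreal (\<bar>\<theta> * \<sigma>\<^sub>2 * \<eta> * lambda_tilde p \<alpha> \<beta> \<alpha>\<^sub>1 \<beta>\<^sub>1\<bar> * enn2real (Lp_norm p x))"
proof -
  have "0 \<le> interval_norm p (\<beta> - \<alpha>) * dual_interval_norm p (\<beta>\<^sub>1 - \<alpha>\<^sub>1)"
    using bounds by (simp add: interval_norm_nonneg dual_interval_norm_nonneg)
  moreover have "lambda_tilde p \<alpha> \<beta> \<alpha>\<^sub>1 \<beta>\<^sub>1
      = interval_norm p (\<beta> - \<alpha>) * dual_interval_norm p (\<beta>\<^sub>1 - \<alpha>\<^sub>1)"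
    using bounds by (intro lambda_tilde_eq p) auto
  ultimately have bound_eq: "\<bar>\<theta> * \<sigma>\<^sub>2 * \<eta> * lambda_tilde p \<alpha> \<beta> \<alpha>\<^sub>1 \<beta>\<^sub>1\<bar>
      = \<bar>- \<theta> * \<sigma>\<^sub>2 * \<eta>\<bar> * (interval_norm p (\<beta> - \<alpha>) * dual_interval_norm p (\<beta>\<^sub>1 - \<alpha>\<^sub>1))"
    by (metis abs_minus_cancel abs_mult abs_of_nonneg mult_minus_left)
  have "\<alpha> \<le> \<beta>"
    using bounds by simp
  then show ?thesis
    unfolding commutator_eq[OF assms] bound_eq
    by (intro Lp_norm_rank_one_le p assms bounds(1) sin_moment_le[OF p assms] window_measurable
        window_le)
qed

end

text \<open>
  The integral is \<open>(sin\<^sup>2 (\<omega> b) - sin\<^sup>2 (\<omega> a)) / (2 \<omega>)\<close>, and the numerator factors as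
  \<open>sin (\<omega> (b + a)) sin (\<omega> (b - a))\<close>; each alternative makes one factor vanish.
\<close>

lemma sin_cos_orthogonal:
  assumes "a \<le> b" and \<omega>: "\<omega> / pi * (b - a) \<in> \<int> \<or> \<omega> / pi * (b + a) \<in> \<int>"
  shows "(LINT s:{a..b}|lebesgue. sin (\<omega> * s) * cos (\<omega> * s)) = 0"
proof (cases "\<omega> = 0")
  case False
  have zero: "sin (\<omega> * c) = 0" if int: "\<omega> / pi * c \<in> \<int>" for c
  proof -
    obtain k where "\<omega> / pi * c = of_int k"
      using int by (auto elim: Ints_cases)
    then have "\<omega> * c = of_int k * pi"
      by (simp add: field_simps)
    then show ?thesis
      by (simp add: sin_zero_iff_int2)
  qed
  have "sin (\<omega> * (b - a)) = 0 \<or> sin (\<omega> * (b + a)) = 0"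
    using \<omega> zero by blast
  then have sq: "(sin (\<omega> * b))\<^sup>2 = (sin (\<omega> * a))\<^sup>2"
  proof -
    have "(sin (\<omega> * b))\<^sup>2 - (sin (\<omega> * a))\<^sup>2 = sin (\<omega> * b + \<omega> * a) * sin (\<omega> * b - \<omega> * a)"
      using sin_cos_squared_add[of "\<omega> * a"] sin_cos_squared_add[of "\<omega> * b"]
      unfolding sin_add sin_diff by algebra
    also have "\<dots> = 0"
      using \<open>sin (\<omega> * (b - a)) = 0 \<or> sin (\<omega> * (b + a)) = 0\<close>
      by (auto simp: distrib_left right_diff_distrib)
    finally show ?thesis by simp
  qed
  have "((\<lambda>s. sin (\<omega> * s) * cos (\<omega> * s)) has_integral
      (sin (\<omega> * b))\<^sup>2 / (2 * \<omega>) - (sin (\<omega> * a))\<^sup>2 / (2 * \<omega>)) {a..b}"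
    using False
    by (intro fundamental_theorem_of_calculus \<open>a \<le> b\<close>)
      (auto intro!: derivative_eq_intros simp flip: has_real_derivative_iff_has_vector_derivative)
  then have "integral {a..b} (\<lambda>s. sin (\<omega> * s) * cos (\<omega> * s)) = 0"
    by (simp add: sq integral_unique)
  moreover have "set_integrable lebesgue {a..b} (\<lambda>s. sin (\<omega> * s) * cos (\<omega> * s))"
    by (intro absolutely_integrable_continuous_real continuous_intros)
  ultimately show ?thesis
    by (simp add: set_lebesgue_integral_eq_integral)
qed simp

lemma cos_square_integral:
  fixes a b \<omega> :: real
  assumes "a \<le> b"
  shows "(LINT s:{a..b}|lebesgue. (cos (\<omega> * s))\<^sup>2)
    = b - a - (LINT s:{a..b}|lebesgue. (sin (\<omega> * s))\<^sup>2)"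
proof -
  have "(LINT s:{a..b}|lebesgue. (cos (\<omega> * s))\<^sup>2) = (LINT s:{a..b}|lebesgue. 1 - (sin (\<omega> * s))\<^sup>2)"
    by (rule set_lebesgue_integral_cong) (simp_all add: cos_squared_eq)
  also have "\<dots> = (LINT s:{a..b}|lebesgue. 1) - (LINT s:{a..b}|lebesgue. (sin (\<omega> * s))\<^sup>2)"
    by (intro set_integral_diff absolutely_integrable_continuous_real continuous_intros)
  also have "(LINT s:{a..b}|lebesgue. 1) = b - a"
    using assms by (simp add: set_lebesgue_integral_def measure_def)
  finally show ?thesis .
qed

text \<open>
  The bound \<open>Lp_norm_commutator_le\<close> holds at every point of the parameter set, so the limit
  follows by squeezing.
\<close>

lemma commutator_tends_to_zero_on_param_set:
  assumes p: "1 \<le> p" and x: "x \<in> Lp p"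
    and lim: "((\<lambda>(\<theta>A, \<theta>B, \<alpha>\<^sub>1, \<beta>\<^sub>1, \<alpha>, \<beta>, \<sigma>\<^sub>1, \<sigma>\<^sub>2, \<delta>, \<omega>).
            \<theta>A * \<sigma>\<^sub>2 * \<theta>B * lambda_tilde p \<alpha> \<beta> \<alpha>\<^sub>1 \<beta>\<^sub>1) \<longlongrightarrow> 0) (at v\<^sub>0 within param_set)"
  shows "((\<lambda>(\<theta>A, \<theta>B, \<alpha>\<^sub>1, \<beta>\<^sub>1, \<alpha>, \<beta>, \<sigma>\<^sub>1, \<sigma>\<^sub>2, \<delta>, \<omega>).
              Lp_norm p (op_diff (opA \<alpha> \<beta> \<alpha>\<^sub>1 \<beta>\<^sub>1 \<sigma>\<^sub>1 \<sigma>\<^sub>2 \<delta> \<omega> \<theta>A \<circ> opB \<alpha> \<beta> \<alpha>\<^sub>1 \<beta>\<^sub>1 \<omega> \<theta>B)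
                                 (opB \<alpha> \<beta> \<alpha>\<^sub>1 \<beta>\<^sub>1 \<omega> \<theta>B \<circ> opA \<alpha> \<beta> \<alpha>\<^sub>1 \<beta>\<^sub>1 \<sigma>\<^sub>1 \<sigma>\<^sub>2 \<delta> \<omega> \<theta>A) x))
            \<longlongrightarrow> 0) (at v\<^sub>0 within param_set)"
    (is "(?N \<longlongrightarrow> 0) _")
proof -
  let ?l = "\<lambda>(\<theta>A, \<theta>B, \<alpha>\<^sub>1, \<beta>\<^sub>1, \<alpha>, \<beta>, \<sigma>\<^sub>1, \<sigma>\<^sub>2, \<delta>, \<omega>).
            \<theta>A * \<sigma>\<^sub>2 * \<theta>B * lambda_tilde p \<alpha> \<beta> \<alpha>\<^sub>1 \<beta>\<^sub>1"
  have "?N v \<le> ennreal (\<bar>?l v\<bar> * enn2real (Lp_norm p x))" if "v \<in> param_set" for v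
  proof -
    obtain \<theta>A \<theta>B \<alpha>\<^sub>1 \<beta>\<^sub>1 \<alpha> \<beta> \<sigma>\<^sub>1 \<sigma>\<^sub>2 \<delta> \<omega> where v: "v = (\<theta>A, \<theta>B, \<alpha>\<^sub>1, \<beta>\<^sub>1, \<alpha>, \<beta>, \<sigma>\<^sub>1, \<sigma>\<^sub>2, \<delta>, \<omega>)"
      by (metis surj_pair)
    interpret orthogonal_trig p \<alpha> \<beta> \<alpha>\<^sub>1 \<beta>\<^sub>1 \<sigma>\<^sub>1 \<sigma>\<^sub>2 \<delta> \<omega>
      using that p by unfold_locales (auto simp: v param_set_def cos_square_integral)
    show ?thesis
      unfolding v prod.case by (rule Lp_norm_commutator_le[OF x])
  qed
  then have "eventually (\<lambda>v. ?N v \<le> ennreal (\<bar>?l v\<bar> * enn2real (Lp_norm p x))) (at v\<^sub>0 within param_set)"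
    by (simp add: eventually_at_filter)
  then show ?thesis
    by (rule tendsto_zero_of_le_ennreal_mult[OF _ lim])
qed

theorem theorem8:
  fixes p :: ennreal
    and \<alpha> \<beta> \<alpha>\<^sub>1 \<beta>\<^sub>1 \<sigma>\<^sub>1 \<sigma>\<^sub>2 \<delta> \<omega> \<theta>A \<theta>B :: real
    and \<theta> \<zeta> :: "nat \<Rightarrow> real"
    and A B A_lim :: fun_op
    and An Bn :: "nat \<Rightarrow> fun_op"
  assumes p: "1 \<le> p"
    and \<delta>: "\<delta> \<noteq> 0"
    and bounds: "\<alpha>\<^sub>1 < \<beta>\<^sub>1" "\<alpha> \<le> \<alpha>\<^sub>1" "\<beta> \<ge> \<beta>\<^sub>1"
    and \<omega>: "\<omega> / pi * (\<beta>\<^sub>1 - \<alpha>\<^sub>1) \<in> \<int> \<or> \<omega> / pi * (\<beta>\<^sub>1 + \<alpha>\<^sub>1) \<in> \<int>"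
    and \<sigma>\<^sub>1: "\<sigma>\<^sub>1 = (LINT s:{\<alpha>\<^sub>1..\<beta>\<^sub>1}|lebesgue. (sin (\<omega> * s))\<^sup>2)" "\<sigma>\<^sub>1 \<noteq> 0"
    and \<sigma>\<^sub>2: "\<sigma>\<^sub>2 = (LINT s:{\<alpha>\<^sub>1..\<beta>\<^sub>1}|lebesgue. (cos (\<omega> * s))\<^sup>2)" "\<sigma>\<^sub>2 \<noteq> 0"
    and A: "A = opA \<alpha> \<beta> \<alpha>\<^sub>1 \<beta>\<^sub>1 \<sigma>\<^sub>1 \<sigma>\<^sub>2 \<delta> \<omega> \<theta>A"
    and B: "B = opB \<alpha> \<beta> \<alpha>\<^sub>1 \<beta>\<^sub>1 \<omega> \<theta>B"
    and An: "\<And>n. An n = opA \<alpha> \<beta> \<alpha>\<^sub>1 \<beta>\<^sub>1 \<sigma>\<^sub>1 \<sigma>\<^sub>2 \<delta> \<omega> (\<theta> n)"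
    and Bn: "\<And>n. Bn n = opB \<alpha> \<beta> \<alpha>\<^sub>1 \<beta>\<^sub>1 \<omega> (\<zeta> n)"
    and A_lim: "A_lim = opA_lim \<alpha> \<beta> \<alpha>\<^sub>1 \<beta>\<^sub>1 \<sigma>\<^sub>1 \<sigma>\<^sub>2 \<delta> \<omega>"
  shows
    "(Lp_operator p A \<and> Lp_operator p B \<and> Lp_operator p A_lim \<and>
      (\<forall>n. Lp_operator p (An n) \<and> Lp_operator p (Bn n)))
   \<and>
     (op_eq p (A \<circ> B) (op_scale \<delta> (B \<circ> A \<circ> A)) \<and>
      (\<forall>n\<ge>1. op_eq p (An n \<circ> B) (op_scale \<delta> (B \<circ> An n \<circ> An n)) \<and>
             op_eq p (An n \<circ> Bn n) (op_scale \<delta> (Bn n \<circ> An n \<circ> An n)) \<and>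
             op_eq p (A \<circ> Bn n) (op_scale \<delta> (Bn n \<circ> A \<circ> A))) \<and>
      (\<forall>x\<in>Lp p. AE t in lebesgue. op_diff (A \<circ> B) (B \<circ> A) x t =
         - \<theta>A * \<sigma>\<^sub>2 * \<theta>B *
         (LINT s:{\<alpha>\<^sub>1..\<beta>\<^sub>1}|lebesgue. indicator {\<alpha>..\<beta>} t * cos (\<omega> * t) * sin (\<omega> * s) * x s)))
   \<and>
     (\<theta> \<longlonglongrightarrow> 0 \<longrightarrow>
        tends_in_norm p An A_lim \<and>
        tends_in_norm p (\<lambda>n. op_diff (An n \<circ> B) (B \<circ> An n)) op_zero \<and>
        op_eq p (A_lim \<circ> B) (B \<circ> A_lim))
   \<and>
     (\<zeta> \<longlonglongrightarrow> 0 \<longrightarrow>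
        tends_in_norm p Bn op_zero \<and>
        tends_in_norm p (\<lambda>n. op_diff (A \<circ> Bn n) (Bn n \<circ> A)) op_zero)
   \<and>
     (\<theta> \<longlonglongrightarrow> 0 \<and> \<zeta> \<longlonglongrightarrow> 0 \<longrightarrow>
        tends_in_norm p (\<lambda>n. op_diff (An n \<circ> Bn n) (Bn n \<circ> An n)) op_zero)
   \<and>
     (\<forall>v\<^sub>0 \<in> closure param_set.
        ((\<lambda>(\<theta>A, \<theta>B, \<alpha>\<^sub>1, \<beta>\<^sub>1, \<alpha>, \<beta>, \<sigma>\<^sub>1, \<sigma>\<^sub>2, \<delta>, \<omega>).
            \<theta>A * \<sigma>\<^sub>2 * \<theta>B * lambda_tilde p \<alpha> \<beta> \<alpha>\<^sub>1 \<beta>\<^sub>1) \<longlongrightarrow> 0) (at v\<^sub>0 within param_set)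
        \<longrightarrow>
        (\<forall>x\<in>Lp p.
          ((\<lambda>(\<theta>A, \<theta>B, \<alpha>\<^sub>1, \<beta>\<^sub>1, \<alpha>, \<beta>, \<sigma>\<^sub>1, \<sigma>\<^sub>2, \<delta>, \<omega>).
              Lp_norm p (op_diff (opA \<alpha> \<beta> \<alpha>\<^sub>1 \<beta>\<^sub>1 \<sigma>\<^sub>1 \<sigma>\<^sub>2 \<delta> \<omega> \<theta>A \<circ> opB \<alpha> \<beta> \<alpha>\<^sub>1 \<beta>\<^sub>1 \<omega> \<theta>B)
                                 (opB \<alpha> \<beta> \<alpha>\<^sub>1 \<beta>\<^sub>1 \<omega> \<theta>B \<circ> opA \<alpha> \<beta> \<alpha>\<^sub>1 \<beta>\<^sub>1 \<sigma>\<^sub>1 \<sigma>\<^sub>2 \<delta> \<omega> \<theta>A) x))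
            \<longlongrightarrow> 0) (at v\<^sub>0 within param_set)))"
proof -
  interpret orthogonal_trig p \<alpha> \<beta> \<alpha>\<^sub>1 \<beta>\<^sub>1 \<sigma>\<^sub>1 \<sigma>\<^sub>2 \<delta> \<omega>
    using p \<delta> bounds \<sigma>\<^sub>1 \<sigma>\<^sub>2 sin_cos_orthogonal[OF _ \<omega>] by unfold_locales auto
  have AnBn: "An = (\<lambda>n. \<A> (\<theta> n))" "Bn = (\<lambda>n. \<B> (\<zeta> n))"
    using An Bn by auto
  have operators: "Lp_operator p (\<A> \<eta>)" "Lp_operator p (\<B> \<eta>)" for \<eta>
    using p bounds by (auto intro: Lp_operator_opA Lp_operator_opB)
  have scaled: "(\<lambda>n. \<eta> n * c) \<longlonglongrightarrow> 0" "(\<lambda>n. c * \<eta> n) \<longlonglongrightarrow> 0"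
    if "\<eta> \<longlonglongrightarrow> 0" for \<eta> :: "nat \<Rightarrow> real" and c
    using tendsto_mult_right[OF that] tendsto_mult_left[OF that] by auto
  have products: "(\<lambda>n. \<theta> n * \<zeta> n) \<longlonglongrightarrow> 0" if "\<theta> \<longlonglongrightarrow> 0" "\<zeta> \<longlonglongrightarrow> 0"
    using tendsto_mult[OF that] by simp
  show ?thesis
    unfolding A B A_lim AnBn opA_lim_eq_opA_0
    by (intro conjI allI impI ballI operators commutation_relation A_tends_in_norm
        B_tends_in_norm A_0_B_commute commutator_tends_to_zero scaled products
        commutator_tends_to_zero_on_param_set[OF p])
      (simp_all add: commutator_integral)
qed

end
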